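(* Let $p\geq 2$ and $k\geq 2$ be integers. Then the algebraic connectivity of the (unrooted) Bethe tree $\mathcal{B}_{p,k}$ satisfies $$a(\mathcal{B}_{p,k})=\frac{1}{\rho(\mathcal{B}_{p-1,k})}\geq \frac{(k-1)^2}{k^p-pk+p-1}.$$
   Context: A rooted tree is a finite tree with a distinguished vertex, its root. For rooted trees $T_1,\dots,T_k$ with roots $r_1,\dots,r_k$, their rooted sum is the rooted tree obtained from the disjoint union of the $T_i$ by joining $r_1,\dots,r_k$ to an additional vertex $r$, which is taken as the root. For integers $p\ge 1$, $k\ge 2$, the rooted Bethe tree $\mathcal{B}_{p,k}$ is defined recursively: $\mathcal{B}_{1,k}$ is the one-vertex rooted tree, and for $p\geq 2$, $\mathcal{B}_{p,k}$ is the rooted sum of $k$ copies of $\mathcal{B}_{p-1,k}$. The unrooted Bethe tree, denoted by the same symbol, is the underlying tree with the root forgotten. For a graph $G$ with diagonal degree matrix $D$ and adjacency matrix $A$, the algebraic connectivity $a(G)$ is the second-smallest eigenvalue (counted with multiplicity) of the Laplacian matrix $L=D-A$. The bottleneck matrix of a rooted tree $T$ with root $r$ is the matrix $M=[m_{ij}]$ indexed by $V(T)$, where $m_{ij}$ is the number of vertices lying both on the path joining $i$ to $r$ and on the path joining $j$ to $r$ (paths include their endpoints). The Perron value $\rho(T)$ is the spectral radius (largest eigenvalue) of $M$. *)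

theory Defs
  imports
    "Graph_Theory.Pair_Digraph"
    "Graph_Theory.Vertex_Walk"
    "Jordan_Normal_Form.Char_Poly"
    "Jordan_Normal_Form.Spectral_Radius"
    "HOL-Computational_Algebra.Polynomial"
begin

text \<open>An undirected graph is a digraph without parallel arcs whose arc set contains, for every
  edge, both orientations. A rooted graph is a pair of a graph and its root.\<close>

type_synonym 'a rooted_graph = "'a pair_pre_digraph \<times> 'a"

text \<open>Vertices are lists of numbers: a vertex \<open>v\<close> of the \<open>i\<close>-th summand becomes \<open>i # v\<close>, which
  makes the union disjoint; the empty list is the additional vertex.\<close>

definition rooted_sum :: "nat \<Rightarrow> (nat \<Rightarrow> nat list rooted_graph) \<Rightarrow> nat list rooted_graph" where
  "rooted_sum k T =
    (\<lparr> pverts = insert [] (\<Union>i<k. (\<lambda>v. i # v) ` pverts (fst (T i))),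
       parcs = (\<Union>i<k. (\<lambda>(u, v). (i # u, i # v)) ` parcs (fst (T i))
                        \<union> {([], i # snd (T i)), (i # snd (T i), [])}) \<rparr>,
     [])"

fun bethe :: "nat \<Rightarrow> nat \<Rightarrow> nat list rooted_graph" where
  "bethe (Suc 0) k = (\<lparr> pverts = {[]}, parcs = {} \<rparr>, [])"
| "bethe (Suc (Suc p)) k = rooted_sum k (\<lambda>_. bethe (Suc p) k)"

text \<open>A matrix indexed by a finite set \<open>V\<close> becomes a matrix indexed by \<open>{0..<card V}\<close> through some
  enumeration of \<open>V\<close>. Another enumeration conjugates it by a permutation matrix, so the
  eigenvalues and their multiplicities do not depend on the choice.\<close>

definition enumeration :: "'a set \<Rightarrow> 'a list" where
  "enumeration V = (SOME xs. distinct xs \<and> set xs = V)"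

definition indexed_mat :: "'a set \<Rightarrow> ('a \<Rightarrow> 'a \<Rightarrow> 'b) \<Rightarrow> 'b mat" where
  "indexed_mat V f =
    mat (card V) (card V) (\<lambda>(i, j). f (enumeration V ! i) (enumeration V ! j))"

definition degree_mat :: "'a pair_pre_digraph \<Rightarrow> real mat" where
  "degree_mat G = indexed_mat (pverts G) (\<lambda>u v. if u = v then real (out_degree G u) else 0)"

definition adjacency_mat :: "'a pair_pre_digraph \<Rightarrow> real mat" where
  "adjacency_mat G = indexed_mat (pverts G) (\<lambda>u v. if (u, v) \<in> parcs G then 1 else 0)"

definition laplacian_mat :: "'a pair_pre_digraph \<Rightarrow> real mat" where
  "laplacian_mat G = degree_mat G - adjacency_mat G"

text \<open>The Laplacian is real symmetric, so the real roots of its characteristic polynomial, taken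
  with multiplicity, are all its eigenvalues; position \<open>1\<close> of the increasing list is the second
  smallest. The value is only meaningful for graphs with at least two vertices.\<close>

definition algebraic_connectivity :: "'a pair_pre_digraph \<Rightarrow> real" where
  "algebraic_connectivity G =
    sorted_list_of_multiset (proots (char_poly (laplacian_mat G))) ! 1"

definition path_to_root :: "'a rooted_graph \<Rightarrow> 'a \<Rightarrow> 'a list" where
  "path_to_root T v =
    (THE xs. vpath xs (with_proj (fst T)) \<and> hd xs = v \<and> last xs = snd T)"

definition bottleneck_mat :: "'a rooted_graph \<Rightarrow> real mat" where
  "bottleneck_mat T = indexed_mat (pverts (fst T))
    (\<lambda>u v. real (card (set (path_to_root T u) \<inter> set (path_to_root T v))))"

text \<open>\<open>spectral_radius\<close> is defined for complex matrices.\<close>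

definition perron_value :: "'a rooted_graph \<Rightarrow> real" where
  "perron_value T = spectral_radius (map_mat complex_of_real (bottleneck_mat T))"

end

theory Submission
  imports Defs "Jordan_Normal_Form.Schur_Decomposition"
begin

text \<open>Write \<open>q = p - 1\<close>. Deleting the root of \<open>B_p\<close> leaves \<open>k\<close> copies of \<open>B_q\<close>, and the
  corresponding principal submatrix of the Laplacian consists of \<open>k\<close> diagonal blocks \<open>K\<close>, where
  \<open>K\<close> is the inverse of the bottleneck matrix of \<open>B_q\<close>. Everything is expressed through the
  smallest eigenvalue \<open>l\<close> of \<open>K\<close>, and \<open>K\<close> itself is never formed.

  By symmetry there is an eigenvector of \<open>K\<close> for \<open>l\<close> that depends only on the level
  of a vertex. Read from the leaves upwards, the eigenvalue equation becomes the three-term recurrence \<open>radial\<close>: a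
  leaf has level \<open>1\<close>, the root of \<open>B_q\<close> level \<open>q\<close>, its deleted parent level \<open>q + 1\<close>,
  and \<open>t\<close> is an eigenvalue of \<open>K\<close> with such an eigenvector exactly if
  \<open>radial k t (q + 1) = 0\<close>. At the first positive root \<open>l\<close> of this polynomial in \<open>t\<close> all lower levels
  are positive (\<open>radial_first_root\<close>), by the intermediate value theorem. Three facts follow.

  \<^item> The level vector is a positive eigenvector of the bottleneck matrix for \<open>1 / l\<close>
    (\<open>bottleneck_radial\<close>). A nonnegative symmetric matrix with a positive eigenvector has the
    corresponding eigenvalue as its spectral radius, whence the Perron value is \<open>1 / l\<close>.

  \<^item> The level vector on one branch of \<open>B_p\<close>, minus the same vector on another branch, is an
    eigenvector of the Laplacian for \<open>l\<close> (\<open>lap_bethe_antisym\<close>). Here \<open>k \<ge> 2\<close> enters.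

  \<^item> Every nonzero Laplacian eigenvalue \<open>e\<close> is at least \<open>l\<close> (\<open>lap_bethe_eigenvalue_ge\<close>). On vectors
    \<open>y\<close> that vanish at the root the quadratic form of the Laplacian is at least \<open>l\<close> times the squared
    norm, by a recursion along the tree that completes one square per edge. An eigenvector \<open>x\<close>
    for \<open>e\<close> is brought into this form by subtracting the constant \<open>x []\<close>. That
    leaves the quadratic form as it is and, since \<open>x\<close> is orthogonal to the constants, does not
    make the norm smaller.

  Zero is a simple root of the characteristic polynomial because the Laplacian is symmetric and its
  kernel consists of the constants; hence \<open>l\<close> is the second smallest root with
  multiplicity. The explicit bound is a
  summation of the recurrence (\<open>radial_root_lower_bound\<close>); it amounts to bounding the Perron value
  by the largest row sum of the bottleneck matrix.\<close>

section \<open>Matrices indexed by finite sets\<close>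

lemma enumeration:
  assumes "finite V"
  shows "distinct (enumeration V)" "set (enumeration V) = V"
proof -
  have "\<exists>xs. distinct xs \<and> set xs = V"
    using finite_distinct_list[OF assms] by blast
  from someI_ex[OF this] show "distinct (enumeration V)" "set (enumeration V) = V"
    unfolding enumeration_def by auto
qed

lemma bij_betw_enumeration:
  assumes "finite V"
  shows "bij_betw (\<lambda>i. enumeration V ! i) {0..<card V} V"
  using bij_betw_nth[OF enumeration(1)[OF assms], of "{0..<card V}" V]
    enumeration[OF assms] distinct_card[OF enumeration(1)[OF assms]]
  by (auto simp: lessThan_atLeast0)

definition indexed_vec :: "'a set \<Rightarrow> ('a \<Rightarrow> 'b) \<Rightarrow> 'b vec" where
  "indexed_vec V x = vec (card V) (\<lambda>i. x (enumeration V ! i))"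

lemma indexed_vec_carrier [simp]: "indexed_vec V x \<in> carrier_vec (card V)"
  by (simp add: indexed_vec_def)

lemma indexed_mat_carrier [simp]: "indexed_mat V f \<in> carrier_mat (card V) (card V)"
  by (simp add: indexed_mat_def)

lemma enumeration_nth_in:
  "finite V \<Longrightarrow> i < card V \<Longrightarrow> enumeration V ! i \<in> V"
  using bij_betw_enumeration[of V] by (auto simp: bij_betw_def)

lemma indexed_mat_cong:
  assumes "finite V" "\<And>u v. u \<in> V \<Longrightarrow> v \<in> V \<Longrightarrow> f u v = g u v"
  shows "indexed_mat V f = indexed_mat V g"
  using assms by (auto simp: indexed_mat_def enumeration_nth_in)

lemma indexed_vec_eq_iff:
  assumes "finite V"
  shows "indexed_vec V x = indexed_vec V y \<longleftrightarrow> (\<forall>v\<in>V. x v = y v)"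
proof -
  have "indexed_vec V x = indexed_vec V y \<longleftrightarrow>
      (\<forall>i\<in>{0..<card V}. x (enumeration V ! i) = y (enumeration V ! i))"
    by (auto simp: indexed_vec_def vec_eq_iff)
  also have "\<dots> \<longleftrightarrow> (\<forall>v\<in>(\<lambda>i. enumeration V ! i) ` {0..<card V}. x v = y v)"
    by simp
  also have "(\<lambda>i. enumeration V ! i) ` {0..<card V} = V"
    using bij_betw_enumeration[OF assms] by (simp add: bij_betw_def)
  finally show ?thesis .
qed

lemma indexed_vec_surj:
  assumes "finite V" "w \<in> carrier_vec (card V)"
  obtains x where "w = indexed_vec V x"
proof
  let ?e = "\<lambda>i. enumeration V ! i"
  have inj: "inj_on ?e {0..<card V}"
    using bij_betw_enumeration[OF assms(1)] by (simp add: bij_betw_def)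
  show "w = indexed_vec V (\<lambda>v. w $ the_inv_into {0..<card V} ?e v)"
    using assms(2) the_inv_into_f_f[OF inj] by (auto simp: indexed_vec_def vec_eq_iff)
qed

lemma indexed_mat_mult_vec:
  assumes "finite V"
  shows "indexed_mat V f *\<^sub>v indexed_vec V x = indexed_vec V (\<lambda>u. \<Sum>v\<in>V. f u v * x v)"
proof (rule eq_vecI)
  fix i assume "i < dim_vec (indexed_vec V (\<lambda>u. \<Sum>v\<in>V. f u v * x v))"
  then have i: "i < card V" by (simp add: indexed_vec_def)
  have "(indexed_mat V f *\<^sub>v indexed_vec V x) $ i =
      (\<Sum>j\<in>{0..<card V}. f (enumeration V ! i) (enumeration V ! j) * x (enumeration V ! j))"
    using i by (simp add: indexed_mat_def indexed_vec_def scalar_prod_def)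
  also have "\<dots> = (\<Sum>v\<in>V. f (enumeration V ! i) v * x v)"
    by (rule sum.reindex_bij_betw[OF bij_betw_enumeration[OF assms],
          of "\<lambda>v. f (enumeration V ! i) v * x v"])
  finally show "(indexed_mat V f *\<^sub>v indexed_vec V x) $ i =
      indexed_vec V (\<lambda>u. \<Sum>v\<in>V. f u v * x v) $ i"
    using i by (simp add: indexed_vec_def)
qed (simp add: indexed_mat_def indexed_vec_def)

lemma eigenvalue_indexed_mat:
  fixes f :: "'a \<Rightarrow> 'a \<Rightarrow> 'b :: comm_ring_1"
  assumes V: "finite V"
  shows "eigenvalue (indexed_mat V f) e \<longleftrightarrow>
    (\<exists>x. (\<exists>v\<in>V. x v \<noteq> 0) \<and> (\<forall>u\<in>V. (\<Sum>v\<in>V. f u v * x v) = e * x u))"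
proof -
  have dim: "dim_row (indexed_mat V f) = card V"
    by (simp add: indexed_mat_def)
  have zero: "0\<^sub>v (card V) = indexed_vec V (\<lambda>_. 0)"
    by (auto simp: indexed_vec_def vec_eq_iff)
  have smult: "e \<cdot>\<^sub>v indexed_vec V x = indexed_vec V (\<lambda>v. e * x v)" for x
    by (auto simp: indexed_vec_def vec_eq_iff)
  have ev: "eigenvector (indexed_mat V f) (indexed_vec V x) e \<longleftrightarrow>
      (\<exists>v\<in>V. x v \<noteq> 0) \<and> (\<forall>u\<in>V. (\<Sum>v\<in>V. f u v * x v) = e * x u)" for x
    unfolding eigenvector_def dim
    by (simp add: zero smult indexed_mat_mult_vec[OF V] indexed_vec_eq_iff[OF V])
  show ?thesis
  proof
    assume "eigenvalue (indexed_mat V f) e"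
    then obtain w where w: "eigenvector (indexed_mat V f) w e"
      by (auto simp: eigenvalue_def)
    then have "w \<in> carrier_vec (card V)"
      by (simp add: eigenvector_def dim)
    with V obtain x where "w = indexed_vec V x"
      by (rule indexed_vec_surj)
    with w ev show "\<exists>x. (\<exists>v\<in>V. x v \<noteq> 0) \<and> (\<forall>u\<in>V. (\<Sum>v\<in>V. f u v * x v) = e * x u)"
      by auto
  qed (auto simp: eigenvalue_def simp flip: ev)
qed

section \<open>Spectral radius and roots of the characteristic polynomial\<close>

text \<open>For a complex eigenvector \<open>x\<close> with eigenvalue \<open>e\<close>, the vector of moduli satisfies \<open>|e| |x| \<le> f |x|\<close>
  entrywise. Pairing this with the positive eigenvector \<open>z\<close> and moving the symmetric matrix to the
  side of \<open>z\<close> gives \<open>|e| \<le> r\<close>.\<close>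

lemma spectral_radius_eq_positive_eigenvalue:
  fixes f :: "'a \<Rightarrow> 'a \<Rightarrow> real"
  assumes V: "finite V" "V \<noteq> {}"
    and sym: "\<And>u v. u \<in> V \<Longrightarrow> v \<in> V \<Longrightarrow> f u v = f v u"
    and nonneg: "\<And>u v. u \<in> V \<Longrightarrow> v \<in> V \<Longrightarrow> f u v \<ge> 0"
    and pos: "\<And>v. v \<in> V \<Longrightarrow> z v > 0"
    and eig: "\<And>u. u \<in> V \<Longrightarrow> (\<Sum>v\<in>V. f u v * z v) = r * z u"
  shows "spectral_radius (map_mat complex_of_real (indexed_mat V f)) = r"
proof -
  let ?A = "indexed_mat V (\<lambda>u v. complex_of_real (f u v))"
  have A: "map_mat complex_of_real (indexed_mat V f) = ?A"
    by (auto simp: indexed_mat_def)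
  have card: "card V > 0"
    using V by (simp add: card_gt_0_iff)
  obtain w where w: "w \<in> V" using V by blast
  have "r * z w \<ge> 0"
    unfolding eig[OF w, symmetric]
    by (intro sum_nonneg mult_nonneg_nonneg nonneg w less_imp_le pos)
  then have r: "r \<ge> 0"
    using pos[OF w] by (simp add: zero_le_mult_iff)
  have "eigenvalue ?A (complex_of_real r)"
    unfolding eigenvalue_indexed_mat[OF V(1)]
  proof (intro exI conjI ballI)
    show "\<exists>v\<in>V. complex_of_real (z v) \<noteq> 0"
      using w pos[OF w] by (intro bexI[of _ w]) auto
    show "(\<Sum>v\<in>V. complex_of_real (f u v) * complex_of_real (z v)) =
        complex_of_real r * complex_of_real (z u)" if "u \<in> V" for u
      unfolding of_real_mult[symmetric] of_real_sum[symmetric] eig[OF that] ..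
  qed
  then have "norm (complex_of_real r) \<in> norm ` spectrum ?A"
    unfolding spectrum_def by blast
  then have ge: "r \<le> spectral_radius ?A"
    using spectral_radius_mem_max(2)[OF indexed_mat_carrier card] r by simp
  obtain e where e: "eigenvalue ?A e" "spectral_radius ?A = norm e"
    using spectral_radius_mem_max(1)[OF indexed_mat_carrier card, of "\<lambda>u v. complex_of_real (f u v)"]
    by (auto simp: spectrum_def)
  obtain x where x: "\<exists>v\<in>V. x v \<noteq> 0"
    "\<And>u. u \<in> V \<Longrightarrow> (\<Sum>v\<in>V. complex_of_real (f u v) * x v) = e * x u"
    using e(1) unfolding eigenvalue_indexed_mat[OF V(1)] by auto
  have le: "norm e * norm (x u) \<le> (\<Sum>v\<in>V. f u v * norm (x v))" if "u \<in> V" for u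
  proof -
    have "norm e * norm (x u) = norm (\<Sum>v\<in>V. complex_of_real (f u v) * x v)"
      by (simp add: x(2)[OF that] norm_mult)
    also have "\<dots> \<le> (\<Sum>v\<in>V. norm (complex_of_real (f u v) * x v))"
      by (rule norm_sum)
    also have "\<dots> = (\<Sum>v\<in>V. f u v * norm (x v))"
      by (intro sum.cong) (auto simp: norm_mult nonneg that)
    finally show ?thesis .
  qed
  define s where "s = (\<Sum>u\<in>V. z u * norm (x u))"
  have "norm e * s = (\<Sum>u\<in>V. z u * (norm e * norm (x u)))"
    by (simp add: s_def sum_distrib_left algebra_simps)
  also have "\<dots> \<le> (\<Sum>u\<in>V. z u * (\<Sum>v\<in>V. f u v * norm (x v)))"
    by (intro sum_mono mult_left_mono le less_imp_le pos)
  also have "\<dots> = (\<Sum>u\<in>V. \<Sum>v\<in>V. z u * f u v * norm (x v))"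
    by (simp add: sum_distrib_left algebra_simps)
  also have "\<dots> = (\<Sum>v\<in>V. \<Sum>u\<in>V. z u * f u v * norm (x v))"
    by (rule sum.swap)
  also have "\<dots> = (\<Sum>v\<in>V. (\<Sum>u\<in>V. f v u * z u) * norm (x v))"
    unfolding sum_distrib_right by (intro sum.cong refl) (simp add: sym)
  also have "\<dots> = r * s"
    by (simp add: eig s_def sum_distrib_left mult.assoc)
  finally have "norm e * s \<le> r * s" .
  moreover have "s > 0"
  proof -
    obtain v where v: "v \<in> V" "x v \<noteq> 0" using x(1) by blast
    show ?thesis
      unfolding s_def using v pos V(1)
      by (intro sum_pos2[of _ v]) (auto simp: less_imp_le)
  qed
  ultimately have "norm e \<le> r" by simp
  with ge e(2) A show ?thesis by simp
qed

text \<open>The vectors are the first two columns of the transition matrix of a Schur decomposition whose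
  triangular factor is arranged to begin with two zero eigenvalues.\<close>

lemma double_zero_char_poly:
  fixes A :: "complex mat"
  assumes A: "A \<in> carrier_mat n n" and dvd: "[:0, 1:] ^ 2 dvd char_poly A"
  obtains v w b where "v \<in> carrier_vec n" "w \<in> carrier_vec n" "A *\<^sub>v v = 0\<^sub>v n"
    "A *\<^sub>v w = b \<cdot>\<^sub>v v" "v \<noteq> 0\<^sub>v n" "\<And>c. w \<noteq> c \<cdot>\<^sub>v v"
proof -
  obtain q where q: "char_poly A = [:0, 1:] ^ 2 * q" using dvd by (elim dvdE)
  obtain as where as: "char_poly A = (\<Prod>a\<leftarrow>as. [:- a, 1:])"
    using char_poly_factorized[OF A] by blast
  have root: "0 \<in> set bs" if "[:0, 1:] dvd (\<Prod>a\<leftarrow>bs. [:- a, 1:])" for bs :: "complex list"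
  proof -
    have "poly (\<Prod>a\<leftarrow>bs. [:- a, 1:]) 0 = 0"
      using that by (elim dvdE) simp
    then show ?thesis
      by (induction bs) auto
  qed
  have "[:0, 1:] dvd (\<Prod>a\<leftarrow>as. [:- a, 1:])"
    unfolding as[symmetric] q by (metis dvd_triv_left mult.assoc power2_eq_square)
  from root[OF this] have 1: "0 \<in># mset as" by simp
  then obtain as' where as': "mset as = mset (0 # as')"
    by (metis ex_mset mset.simps(2) multi_member_split)
  have prod_eq: "(\<Prod>a\<leftarrow>as. [:- a, 1:]) = (\<Prod>a\<leftarrow>cs. [:- a, 1:])" if "mset as = mset cs" for cs
    using arg_cong[OF that, of "\<lambda>M. \<Prod>a\<in>#M. [:- a, 1:]"] by (simp flip: mset_map prod_mset_prod_list)
  have "[:0, 1:] * ([:0, 1:] * q) = [:0, 1:] * (\<Prod>a\<leftarrow>as'. [:- a, 1:])"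
    using as q prod_eq[OF as'] by (simp add: power2_eq_square)
  then have "[:0, 1:] * q = (\<Prod>a\<leftarrow>as'. [:- a, 1:])"
    unfolding mult_cancel_left by auto
  then have "[:0, 1:] dvd (\<Prod>a\<leftarrow>as'. [:- a, 1:])"
    by (metis dvd_triv_left)
  from root[OF this] have "0 \<in># mset as'" by simp
  then obtain bs where bs: "mset as' = mset (0 # bs)"
    by (metis ex_mset mset.simps(2) multi_member_split)
  have fact: "char_poly A = (\<Prod>a\<leftarrow>0 # 0 # bs. [:- a, 1:])"
    using as prod_eq[of "0 # 0 # bs"] as' bs by simp
  obtain B P Q where BPQ: "schur_decomposition A (0 # 0 # bs) = (B, P, Q)"
    by (metis prod_cases3)
  from schur_decomposition[OF A fact BPQ]
  have wit: "similar_mat_wit A B P Q" and ut: "upper_triangular B"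
    and diag: "diag_mat B = 0 # 0 # bs" by auto
  from wit A have c: "B \<in> carrier_mat n n" "P \<in> carrier_mat n n" "Q \<in> carrier_mat n n"
    and PQ: "P * Q = 1\<^sub>m n" "Q * P = 1\<^sub>m n" and AB: "A = P * B * Q"
    by (auto simp: similar_mat_wit_def Let_def)
  have n: "n \<ge> 2" using arg_cong[OF diag, of length] c by (simp add: diag_mat_def)
  have B00: "B $$ (0, 0) = 0" using arg_cong[OF diag, of "\<lambda>xs. xs ! 0"] c n
    by (simp add: diag_mat_def)
  have B11: "B $$ (1, 1) = 0" using arg_cong[OF diag, of "\<lambda>xs. xs ! 1"] c n
    by (simp add: diag_mat_def)
  let ?b = "B $$ (0, 1)"
  have col0: "B *\<^sub>v unit_vec n 0 = 0\<^sub>v n"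
  proof (rule eq_vecI)
    fix i assume "i < dim_vec (0\<^sub>v n)"
    then show "(B *\<^sub>v unit_vec n 0) $ i = 0\<^sub>v n $ i"
      using c n B00 ut by (cases "i = 0") (auto simp: upper_triangular_def)
  qed (use c in auto)
  have col1: "B *\<^sub>v unit_vec n 1 = ?b \<cdot>\<^sub>v unit_vec n 0"
  proof (rule eq_vecI)
    fix i assume "i < dim_vec (?b \<cdot>\<^sub>v unit_vec n 0)"
    then show "(B *\<^sub>v unit_vec n 1) $ i = (?b \<cdot>\<^sub>v unit_vec n 0) $ i"
      using c n B11 ut by (cases "i = 0"; cases "i = 1") (auto simp: upper_triangular_def)
  qed (use c in auto)
  have QP: "Q *\<^sub>v (P *\<^sub>v x) = x" if x: "x \<in> carrier_vec n" for x
    using assoc_mult_mat_vec[OF c(3,2) x] PQ(2) x by simp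
  have AP: "A *\<^sub>v (P *\<^sub>v x) = P *\<^sub>v (B *\<^sub>v x)" if x: "x \<in> carrier_vec n" for x
  proof -
    have "A *\<^sub>v (P *\<^sub>v x) = (P * B) *\<^sub>v (Q *\<^sub>v (P *\<^sub>v x))"
      unfolding AB by (rule assoc_mult_mat_vec) (use c x in auto)
    also have "\<dots> = P *\<^sub>v (B *\<^sub>v x)"
      unfolding QP[OF x] by (rule assoc_mult_mat_vec) (use c x in auto)
    finally show ?thesis .
  qed
  have inj: "x = y" if "P *\<^sub>v x = P *\<^sub>v y" "x \<in> carrier_vec n" "y \<in> carrier_vec n" for x y
    using arg_cong[OF that(1), of "\<lambda>w. Q *\<^sub>v w"] unfolding QP[OF that(2)] QP[OF that(3)] .
  show ?thesis
  proof (rule that[of "P *\<^sub>v unit_vec n 0" "P *\<^sub>v unit_vec n 1" ?b])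
    show "A *\<^sub>v (P *\<^sub>v unit_vec n 0) = 0\<^sub>v n"
      using AP[of "unit_vec n 0"] col0 c by auto
    show "A *\<^sub>v (P *\<^sub>v unit_vec n 1) = ?b \<cdot>\<^sub>v (P *\<^sub>v unit_vec n 0)"
      using AP[of "unit_vec n 1"] col1 c by (auto simp: mult_mat_vec)
    have z: "0\<^sub>v n = P *\<^sub>v 0\<^sub>v n" using c by auto
    show "P *\<^sub>v unit_vec n 0 \<noteq> 0\<^sub>v n"
    proof
      assume "P *\<^sub>v unit_vec n 0 = 0\<^sub>v n"
      then have "unit_vec n 0 = (0\<^sub>v n :: complex vec)"
        using inj[of "unit_vec n 0" "0\<^sub>v n"] z by auto
      from arg_cong[OF this, of "\<lambda>v. v $ 0"] show False using n by simp
    qed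
    show "P *\<^sub>v unit_vec n 1 \<noteq> d \<cdot>\<^sub>v (P *\<^sub>v unit_vec n 0)" for d
    proof
      assume "P *\<^sub>v unit_vec n 1 = d \<cdot>\<^sub>v (P *\<^sub>v unit_vec n 0)"
      also have "\<dots> = P *\<^sub>v (d \<cdot>\<^sub>v unit_vec n 0)" using c by (auto simp: mult_mat_vec)
      finally have "unit_vec n 1 = d \<cdot>\<^sub>v unit_vec n 0"
        by (rule inj) auto
      from arg_cong[OF this, of "\<lambda>v. v $ 1"] show False using n by simp
    qed
  qed (use c in auto)
qed

text \<open>If zero were a double root there would be \<open>v\<close> and \<open>w\<close> with \<open>f v = 0\<close> and \<open>f w = b v\<close>, as in the previous
  lemma, over the complex numbers. Then \<open>v\<close> is constant, and as the columns sum to zero, so do the entries of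
  \<open>f w\<close>; this forces \<open>b = 0\<close>. Hence \<open>w\<close> is constant as well, a multiple of \<open>v\<close>.\<close>

lemma order_0_char_poly_of_constant_kernel:
  fixes f :: "'a \<Rightarrow> 'a \<Rightarrow> real"
  assumes V: "finite V" "V \<noteq> {}"
    and rows: "\<And>u. u \<in> V \<Longrightarrow> (\<Sum>v\<in>V. f u v) = 0"
    and cols: "\<And>v. v \<in> V \<Longrightarrow> (\<Sum>u\<in>V. f u v) = 0"
    and kernel: "\<And>x u v. (\<And>u. u \<in> V \<Longrightarrow> (\<Sum>v\<in>V. f u v * x v) = 0) \<Longrightarrow>
      u \<in> V \<Longrightarrow> v \<in> V \<Longrightarrow> x u = x v"
  shows "order 0 (char_poly (indexed_mat V f)) = 1"
proof -
  let ?A = "indexed_mat V (\<lambda>u v. complex_of_real (f u v))"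
  let ?p = "char_poly (indexed_mat V f)"
  have nz: "?p \<noteq> 0"
    using degree_monic_char_poly[OF indexed_mat_carrier, of V f] by auto
  have A: "map_mat complex_of_real (indexed_mat V f) = ?A"
    by (auto simp: indexed_mat_def)
  have "eigenvalue (indexed_mat V f) 0"
    unfolding eigenvalue_indexed_mat[OF V(1)] using V(2) rows
    by (intro exI[of _ "\<lambda>_. 1"]) auto
  then have "poly ?p 0 = 0"
    using eigenvalue_root_char_poly[OF indexed_mat_carrier] by blast
  then have "order 0 ?p \<noteq> 0"
    using nz by (simp add: order_root)
  moreover have "\<not> 2 \<le> order 0 ?p"
  proof
    assume "2 \<le> order 0 ?p"
    then have "[:0, 1:] ^ 2 dvd ?p"
      using order_divides[of 0 2 ?p] by simp
    then obtain q where q: "?p = [:0, 1:] ^ 2 * q" by (elim dvdE)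
    interpret h: map_poly_comm_ring_hom complex_of_real ..
    have "char_poly ?A = map_poly complex_of_real ?p"
      unfolding A[symmetric] by (rule of_real_hom.char_poly_hom[OF indexed_mat_carrier])
    also have "\<dots> = [:0, 1:] ^ 2 * map_poly complex_of_real q"
      unfolding q by (simp only: h.hom_mult h.hom_power) simp
    finally have "[:0, 1:] ^ 2 dvd char_poly ?A" by simp
    then obtain v w b where vw: "v \<in> carrier_vec (card V)" "w \<in> carrier_vec (card V)"
      "?A *\<^sub>v v = 0\<^sub>v (card V)" "?A *\<^sub>v w = b \<cdot>\<^sub>v v" "v \<noteq> 0\<^sub>v (card V)" "\<And>c. w \<noteq> c \<cdot>\<^sub>v v"
      using double_zero_char_poly[OF indexed_mat_carrier] by metis
    obtain x where x: "v = indexed_vec V x" by (rule indexed_vec_surj[OF V(1) vw(1)])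
    obtain y where y: "w = indexed_vec V y" by (rule indexed_vec_surj[OF V(1) vw(2)])
    have zero: "0\<^sub>v (card V) = indexed_vec V (\<lambda>_. 0)"
      by (auto simp: indexed_vec_def vec_eq_iff)
    have smult: "e \<cdot>\<^sub>v indexed_vec V x = indexed_vec V (\<lambda>v. e * x v)" for x and e :: complex
      by (auto simp: indexed_vec_def vec_eq_iff)
    have const: "g u = g u'"
      if g: "\<forall>u\<in>V. (\<Sum>v\<in>V. complex_of_real (f u v) * g v) = 0" and u: "u \<in> V" "u' \<in> V"
      for g u u'
    proof (rule complex_eqI)
      show "Re (g u) = Re (g u')"
        using arg_cong[OF bspec[OF g], of _ Re] u by (intro kernel) (auto)
      show "Im (g u) = Im (g u')"
        using arg_cong[OF bspec[OF g], of _ Im] u by (intro kernel) (auto)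
    qed
    have kx: "\<forall>u\<in>V. (\<Sum>v\<in>V. complex_of_real (f u v) * x v) = 0"
      using vw(3) unfolding x zero indexed_mat_mult_vec[OF V(1)] indexed_vec_eq_iff[OF V(1)] .
    have ky: "\<forall>u\<in>V. (\<Sum>v\<in>V. complex_of_real (f u v) * y v) = b * x u"
      using vw(4) unfolding x y smult indexed_mat_mult_vec[OF V(1)] indexed_vec_eq_iff[OF V(1)] .
    obtain r where r: "r \<in> V" using V by blast
    have xr: "\<forall>u\<in>V. x u = x r" using const[OF kx _ r] by blast
    have x0: "x r \<noteq> 0"
      using vw(5) xr unfolding x zero indexed_vec_eq_iff[OF V(1)] by auto
    have "(\<Sum>u\<in>V. \<Sum>v\<in>V. complex_of_real (f u v) * y v) =
        (\<Sum>v\<in>V. complex_of_real (\<Sum>u\<in>V. f u v) * y v)"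
      by (subst sum.swap) (simp add: sum_distrib_right)
    also have "\<dots> = 0" by (simp add: cols)
    also have "(\<Sum>u\<in>V. \<Sum>v\<in>V. complex_of_real (f u v) * y v) = of_nat (card V) * (b * x r)"
      using ky xr by simp
    finally have b: "b = 0" using V x0 by (auto simp: card_eq_0_iff)
    have "y u = y r / x r * x u" if u: "u \<in> V" for u
    proof -
      have "y u = y r"
        by (rule const[OF _ u r]) (use ky b in simp)
      moreover have "x u = x r" using xr u by blast
      ultimately show ?thesis using x0 by simp
    qed
    then have "w = (y r / x r) \<cdot>\<^sub>v v"
      unfolding x y smult indexed_vec_eq_iff[OF V(1)] by blast
    with vw(6) show False by blast
  qed
  ultimately show ?thesis by linarith
qed

lemma nth_1_sorted_list_of_multiset:
  fixes a b :: "'a :: linorder"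
  assumes "count M a = 1" "b \<in># M" "a < b" "\<And>x. x \<in># M \<Longrightarrow> x \<noteq> a \<Longrightarrow> b \<le> x"
  shows "sorted_list_of_multiset M ! 1 = b"
proof -
  obtain N where N: "M = add_mset b N"
    using assms(2) by (metis multi_member_split)
  have "count N a = 1"
    using assms(1,3) unfolding N by (simp split: if_splits)
  then have "a \<in># N"
    by (metis count_eq_zero_iff zero_neq_one)
  then obtain K where K: "N = add_mset a K"
    by (metis multi_member_split)
  have "a \<notin># K" using assms(1) unfolding N K
    by (simp add: not_in_iff split: if_splits)
  then have K_ge: "b \<le> x" if "x \<in># K" for x
    using assms(4)[of x] that unfolding N K by auto
  have "sorted_list_of_multiset M = insort a (insort b (sorted_list_of_multiset K))"
    unfolding N K by (simp add: add_mset_commute)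
  also have "insort b (sorted_list_of_multiset K) = b # sorted_list_of_multiset K"
    using K_ge by (intro insort_is_Cons) auto
  also have "insort a \<dots> = a # \<dots>"
    using assms(3) by (simp add: less_imp_le)
  finally show ?thesis by simp
qed

lemma second_root_char_poly:
  fixes A :: "real mat"
  assumes A: "A \<in> carrier_mat n n" and order: "order 0 (char_poly A) = 1"
    and l: "l > 0" "eigenvalue A l"
    and gap: "\<And>e. eigenvalue A e \<Longrightarrow> e \<noteq> 0 \<Longrightarrow> l \<le> e"
  shows "sorted_list_of_multiset (proots (char_poly A)) ! 1 = l"
proof -
  have nz: "char_poly A \<noteq> 0"
    using degree_monic_char_poly[OF A] by auto
  have mem: "e \<in># proots (char_poly A) \<longleftrightarrow> eigenvalue A e" for e
    using nz eigenvalue_root_char_poly[OF A] by (simp add: set_count_proots)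
  show ?thesis
    by (rule nth_1_sorted_list_of_multiset[of _ 0]) (use order l gap mem nz in \<open>auto simp: count_proots\<close>)
qed

section \<open>The radial recurrence and its first root\<close>

text \<open>Value at level \<open>n\<close> of a function on the tree that depends only on the level and satisfies the eigenvalue
  equation \<open>(k + 1) f n - k f (n - 1) - f (n + 1) = t f n\<close> of a vertex with \<open>k\<close> children and one
  parent. Level \<open>0\<close> is fictitious: the equation of a leaf, \<open>f 1 - f 2 = t f 1\<close>, is the general one with
  \<open>f 0 = f 1\<close>.\<close>

fun radial :: "real \<Rightarrow> real \<Rightarrow> nat \<Rightarrow> real" where
  "radial k t 0 = 1"
| "radial k t (Suc 0) = 1"
| "radial k t (Suc (Suc n)) = (k + 1 - t) * radial k t (Suc n) - k * radial k t n"

declare radial.simps(3) [simp del]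

lemma continuous_on_radial: "continuous_on S (\<lambda>t. radial k t n)"
proof (induction n rule: less_induct)
  case (less n)
  consider "n = 0" | "n = 1" | m where "n = Suc (Suc m)"
    by (metis One_nat_def not0_implies_Suc)
  then show ?case
    by cases (use less in \<open>auto simp: radial.simps(3) intro!: continuous_intros\<close>)
qed

lemma radial_at_0: "radial k 0 n = 1"
proof (induction n rule: less_induct)
  case (less n)
  consider "n = 0" | "n = 1" | m where "n = Suc (Suc m)"
    by (metis One_nat_def not0_implies_Suc)
  then show ?case
    by cases (use less in \<open>auto simp: radial.simps(3)\<close>)
qed

text \<open>The first roots decrease with the level: at the first root \<open>m\<close> for level \<open>n + 2\<close> the recurrence makes
  level \<open>n + 3\<close> equal to \<open>-k\<close> times the positive level \<open>n + 1\<close>, whereas it is \<open>1\<close> at \<open>t = 0\<close>. So level \<open>n + 3\<close>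
  has its first root before \<open>m\<close>, where all the lower levels are still positive. Positivity on the
  whole interval up to the root is carried along for the induction.\<close>

lemma radial_first_root:
  assumes k: "k > 0"
  shows "\<exists>l>0. radial k l (Suc (Suc n)) = 0 \<and>
    (\<forall>t. 0 \<le> t \<and> t < l \<longrightarrow> radial k t (Suc (Suc n)) > 0) \<and>
    (\<forall>t j. 0 \<le> t \<and> t \<le> l \<and> j \<le> Suc n \<longrightarrow> radial k t j > 0)"
proof (induction n)
  case 0
  have "radial k t j = 1" if "j \<le> Suc 0" for t j
    using that by (cases j) auto
  then show ?case by (intro exI[of _ 1]) (auto simp: radial.simps(3) algebra_simps)
next
  case (Suc n)
  let ?g = "\<lambda>t. radial k t (Suc (Suc (Suc n)))"
  obtain m where m: "m > 0" "radial k m (Suc (Suc n)) = 0"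
    and m_less: "\<And>t. 0 \<le> t \<Longrightarrow> t < m \<Longrightarrow> radial k t (Suc (Suc n)) > 0"
    and m_pos: "\<And>t j. 0 \<le> t \<Longrightarrow> t \<le> m \<Longrightarrow> j \<le> Suc n \<Longrightarrow> radial k t j > 0"
    using Suc.IH by blast
  have gm: "?g m < 0" using m m_pos[of m "Suc n"] k by (simp add: radial.simps(3)[of _ _ "Suc n"])
  let ?S = "{0..m} \<inter> ?g -` {..0}"
  \<comment> \<open>The first root is taken as the least point where the continuous function is not positive.\<close>
  have S: "compact ?S"
    by (intro compact_Int_closed compact_Icc closed_vimage continuous_on_radial closed_atMost)
  have "m \<in> ?S" using gm m(1) by simp
  then have "?S \<noteq> {}" by blast
  from compact_attains_inf[OF S this]
  obtain l where l: "l \<in> ?S" "\<And>t. t \<in> ?S \<Longrightarrow> l \<le> t"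
    by (elim bexE) blast
  obtain t where t: "0 \<le> t" "t \<le> l" "?g t = 0"
    using IVT2'[of ?g l 0 0] l(1) by (auto simp: radial_at_0 continuous_on_radial)
  with l(1) have "l \<le> t" by (intro l(2)) auto
  with t have l0: "?g l = 0" by simp
  have lm: "l < m" using l0 gm l(1) by (cases "l = m") auto
  have lpos: "l > 0" using l0 l(1) radial_at_0[of k "Suc (Suc (Suc n))"] by (cases "l = 0") auto
  show ?case
  proof (intro exI conjI allI impI)
    show "?g t > 0" if "0 \<le> t \<and> t < l" for t
      using l(2)[of t] that lm by (auto simp: not_le[symmetric])
    show "radial k t j > 0" if "0 \<le> t \<and> t \<le> l \<and> j \<le> Suc (Suc n)" for t j
      using that m_pos[of t j] m_less[of t] lm by (cases "j = Suc (Suc n)") auto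
  qed (use l0 lpos in auto)
qed

text \<open>The decrements \<open>d n\<close> between consecutive levels satisfy \<open>d n = l f n + k d (n - 1)\<close>, so they are
  nonnegative and \<open>f \<le> 1\<close>. Hence \<open>d n \<le> l (1 + k + \<dots> + k^(n - 1))\<close>, and adding up the decrements
  telescopes to the claim. The powers of \<open>k - 1\<close> clear the denominators of the geometric sums.\<close>

lemma radial_root_lower_bound:
  fixes k l :: real
  assumes k: "k \<ge> 1" and l: "l > 0" and pos: "\<And>j. j \<le> q \<Longrightarrow> radial k l j > 0"
  shows "(k - 1)\<^sup>2 * (1 - radial k l (Suc q)) \<le> l * (k ^ Suc q - real (Suc q) * k + real q)"
proof -
  define d where "d n = radial k l n - radial k l (Suc n)" for n
  have d_Suc: "d (Suc n) = l * radial k l (Suc n) + k * d n" for n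
    by (simp add: d_def radial.simps(3) algebra_simps)
  have "0 \<le> d n \<and> radial k l n \<le> 1 \<and> (k - 1) * d n \<le> l * (k ^ n - 1) \<and>
      (k - 1)\<^sup>2 * (1 - radial k l (Suc n)) \<le> l * (k ^ Suc n - real (Suc n) * k + real n)"
    if "n \<le> q" for n
    using that
  proof (induction n)
    case 0
    then show ?case by (simp add: d_def)
  next
    case (Suc n)
    then have IH: "0 \<le> d n" "radial k l n \<le> 1" "(k - 1) * d n \<le> l * (k ^ n - 1)"
      "(k - 1)\<^sup>2 * (1 - radial k l (Suc n)) \<le> l * (k ^ Suc n - real (Suc n) * k + real n)"
      by auto
    have p: "radial k l (Suc n) > 0" using pos Suc.prems by blast
    have 1: "d (Suc n) \<ge> 0" unfolding d_Suc using IH(1) p k l by simp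
    have 2: "radial k l (Suc n) \<le> 1" using IH(1,2) by (simp add: d_def)
    have "(k - 1) * d (Suc n) = l * ((k - 1) * radial k l (Suc n)) + k * ((k - 1) * d n)"
      by (simp add: d_Suc algebra_simps)
    also have "\<dots> \<le> l * ((k - 1) * 1) + k * (l * (k ^ n - 1))"
      using IH(3) 2 k l by (intro add_mono mult_left_mono) auto
    also have "\<dots> = l * (k ^ Suc n - 1)" by (simp add: algebra_simps)
    finally have 3: "(k - 1) * d (Suc n) \<le> l * (k ^ Suc n - 1)" .
    have "(k - 1)\<^sup>2 * (1 - radial k l (Suc (Suc n))) =
        (k - 1)\<^sup>2 * (1 - radial k l (Suc n)) + (k - 1) * ((k - 1) * d (Suc n))"
      by (simp add: d_def power2_eq_square algebra_simps)
    also have "\<dots> \<le> l * (k ^ Suc n - real (Suc n) * k + real n) + (k - 1) * (l * (k ^ Suc n - 1))"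
      using IH(4) 3 k by (intro add_mono mult_left_mono) auto
    also have "\<dots> = l * (k ^ Suc (Suc n) - real (Suc (Suc n)) * k + real (Suc n))"
      by (simp add: algebra_simps)
    finally show ?case using 1 2 3 by blast
  qed
  then show ?thesis by blast
qed

section \<open>Recursive structure of Bethe trees\<close>

lemma bethe_root [simp]: "snd (bethe (Suc p) k) = []"
  by (cases p) (auto simp: rooted_sum_def)

lemma parcs_bethe_1 [simp]: "parcs (fst (bethe (Suc 0) k)) = {}"
  by simp

lemma pverts_bethe_1 [simp]: "pverts (fst (bethe (Suc 0) k)) = {[]}"
  by simp

lemma pverts_bethe_Suc:
  "pverts (fst (bethe (Suc (Suc p)) k)) =
    insert [] (\<Union>i<k. (#) i ` pverts (fst (bethe (Suc p) k)))"
  by (simp add: rooted_sum_def)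

lemma parcs_bethe_Suc:
  "(u, v) \<in> parcs (fst (bethe (Suc (Suc p)) k)) \<longleftrightarrow>
    (\<exists>i<k. \<exists>u' v'. u = i # u' \<and> v = i # v' \<and> (u', v') \<in> parcs (fst (bethe (Suc p) k))) \<or>
    (\<exists>i<k. u = [] \<and> v = [i]) \<or> (\<exists>i<k. u = [i] \<and> v = [])"
  by (auto simp: rooted_sum_def)

declare bethe.simps [simp del]

lemma Nil_in_bethe: "[] \<in> pverts (fst (bethe (Suc p) k))"
  by (cases p) (auto simp: pverts_bethe_1 pverts_bethe_Suc)

lemma finite_pverts_bethe: "finite (pverts (fst (bethe (Suc p) k)))"
  by (induction p) (auto simp: pverts_bethe_1 pverts_bethe_Suc)

lemma bethe_wf:
  "(u, v) \<in> parcs (fst (bethe (Suc p) k)) \<Longrightarrow>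
    u \<in> pverts (fst (bethe (Suc p) k)) \<and> v \<in> pverts (fst (bethe (Suc p) k))"
proof (induction p arbitrary: u v)
  case (Suc p)
  then show ?case
    unfolding parcs_bethe_Suc pverts_bethe_Suc using Nil_in_bethe[of p k] by blast
qed simp

lemma bethe_symmetric:
  "(u, v) \<in> parcs (fst (bethe (Suc p) k)) \<Longrightarrow> (v, u) \<in> parcs (fst (bethe (Suc p) k))"
proof (induction p arbitrary: u v)
  case (Suc p)
  then show ?case unfolding parcs_bethe_Suc by blast
qed simp

lemma sum_pverts_bethe_Suc:
  fixes g :: "nat list \<Rightarrow> 'b :: comm_monoid_add"
  shows "(\<Sum>v\<in>pverts (fst (bethe (Suc (Suc p)) k)). g v) =
    g [] + (\<Sum>i<k. \<Sum>v\<in>pverts (fst (bethe (Suc p) k)). g (i # v))"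
proof -
  have "(\<Sum>v\<in>pverts (fst (bethe (Suc (Suc p)) k)). g v) =
      g [] + (\<Sum>v\<in>(\<Union>i<k. (#) i ` pverts (fst (bethe (Suc p) k))). g v)"
    unfolding pverts_bethe_Suc by (subst sum.insert) (auto simp: finite_pverts_bethe)
  also have "(\<Sum>v\<in>(\<Union>i<k. (#) i ` pverts (fst (bethe (Suc p) k))). g v) =
      (\<Sum>i<k. \<Sum>v\<in>(#) i ` pverts (fst (bethe (Suc p) k)). g v)"
    by (subst sum.UNION_disjoint) (auto simp: finite_pverts_bethe)
  also have "\<dots> = (\<Sum>i<k. \<Sum>v\<in>pverts (fst (bethe (Suc p) k)). g (i # v))"
    by (rule sum.cong) (simp_all add: sum.reindex)
  finally show ?thesis .
qed

section \<open>The Laplacian and its quadratic form\<close>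

definition lap :: "'a pair_pre_digraph \<Rightarrow> ('a \<Rightarrow> real) \<Rightarrow> 'a \<Rightarrow> real" where
  "lap G x u = (\<Sum>v\<in>{v. (u, v) \<in> parcs G}. x u - x v)"

definition lap_entry :: "'a pair_pre_digraph \<Rightarrow> 'a \<Rightarrow> 'a \<Rightarrow> real" where
  "lap_entry G u v = (if u = v then real (out_degree G u) else 0) - (if (u, v) \<in> parcs G then 1 else 0)"

lemma laplacian_mat_eq: "laplacian_mat G = indexed_mat (pverts G) (lap_entry G)"
  by (auto simp: laplacian_mat_def degree_mat_def adjacency_mat_def indexed_mat_def lap_entry_def)

lemma sum_lap_entry:
  assumes fin: "finite (pverts G)" and wf: "\<And>u v. (u, v) \<in> parcs G \<Longrightarrow> v \<in> pverts G"
    and u: "u \<in> pverts G"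
  shows "(\<Sum>v\<in>pverts G. lap_entry G u v * x v) = lap G x u"
proof -
  let ?N = "{v. (u, v) \<in> parcs G}"
  have N: "?N \<subseteq> pverts G" using wf by auto
  have "out_arcs (with_proj G) u = Pair u ` ?N"
    by (auto simp: out_arcs_def)
  then have deg: "out_degree G u = card ?N"
    by (simp add: out_degree_def card_image inj_on_def)
  have "(\<Sum>v\<in>pverts G. lap_entry G u v * x v) =
      (\<Sum>v\<in>pverts G. if u = v then real (card ?N) * x v else 0) -
      (\<Sum>v\<in>pverts G. if v \<in> ?N then x v else 0)"
    unfolding sum_subtractf[symmetric] lap_entry_def deg
    by (intro sum.cong) (auto simp: algebra_simps)
  also have "\<dots> = real (card ?N) * x u - (\<Sum>v\<in>?N. x v)"
    using sum.inter_restrict[OF fin, of x ?N] N fin u by (simp add: Int_absorb1)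
  also have "\<dots> = lap G x u"
    by (simp add: lap_def sum_subtractf)
  finally show ?thesis .
qed

lemma lap_bethe_1 [simp]: "lap (fst (bethe (Suc 0) k)) x u = 0"
  by (simp add: lap_def)

lemma lap_bethe_Nil:
  "lap (fst (bethe (Suc (Suc p)) k)) x [] = (\<Sum>i<k. x [] - x [i])"
proof -
  have "{v. ([], v) \<in> parcs (fst (bethe (Suc (Suc p)) k))} = (\<lambda>i. [i]) ` {..<k}"
    unfolding parcs_bethe_Suc by auto
  then show ?thesis by (simp add: lap_def sum.reindex inj_on_def)
qed

lemma lap_bethe_Cons:
  assumes i: "i < k"
  shows "lap (fst (bethe (Suc (Suc p)) k)) x (i # u) =
    lap (fst (bethe (Suc p) k)) (\<lambda>v. x (i # v)) u + (if u = [] then x [i] - x [] else 0)"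
proof -
  let ?N = "{v. (u, v) \<in> parcs (fst (bethe (Suc p) k))}"
  have "{v. (i # u, v) \<in> parcs (fst (bethe (Suc (Suc p)) k))} =
      (#) i ` ?N \<union> (if u = [] then {[]} else {})"
    unfolding parcs_bethe_Suc using i by auto
  moreover have "finite ?N"
    by (rule finite_subset[OF _ finite_pverts_bethe[of p k]]) (use bethe_wf in auto)
  ultimately show ?thesis
    by (cases "u = []") (simp_all add: lap_def sum.reindex image_iff)
qed

lemma sum_lap_bethe: "(\<Sum>u\<in>pverts (fst (bethe (Suc p) k)). lap (fst (bethe (Suc p) k)) x u) = 0"
proof (induction p arbitrary: x)
  case (Suc p)
  show ?case
    unfolding sum_pverts_bethe_Suc lap_bethe_Nil
    by (simp add: lap_bethe_Cons sum.distrib Suc.IH finite_pverts_bethe Nil_in_bethe sum.delta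
        flip: sum.distrib)
qed simp

definition dirichlet :: "nat \<Rightarrow> nat \<Rightarrow> (nat list \<Rightarrow> real) \<Rightarrow> real" where
  "dirichlet p k x = (\<Sum>u\<in>pverts (fst (bethe p k)). x u * lap (fst (bethe p k)) x u)"

definition sq_norm :: "nat \<Rightarrow> nat \<Rightarrow> (nat list \<Rightarrow> real) \<Rightarrow> real" where
  "sq_norm p k x = (\<Sum>u\<in>pverts (fst (bethe p k)). (x u)\<^sup>2)"

lemma dirichlet_1: "dirichlet (Suc 0) k x = 0"
  by (simp add: dirichlet_def)

lemma sq_norm_1: "sq_norm (Suc 0) k x = (x [])\<^sup>2"
  by (simp add: sq_norm_def)

lemma sq_norm_Suc:
  "sq_norm (Suc (Suc p)) k x = (x [])\<^sup>2 + (\<Sum>i<k. sq_norm (Suc p) k (\<lambda>v. x (i # v)))"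
  unfolding sq_norm_def sum_pverts_bethe_Suc ..

text \<open>Unfolded completely, this says that the quadratic form is the sum of the squared differences over all
  edges.\<close>

lemma dirichlet_Suc:
  "dirichlet (Suc (Suc p)) k x =
    (\<Sum>i<k. dirichlet (Suc p) k (\<lambda>v. x (i # v)) + (x [] - x [i])\<^sup>2)"
proof -
  let ?V = "pverts (fst (bethe (Suc p) k))"
  have "(\<Sum>v\<in>?V. x (i # v) * lap (fst (bethe (Suc (Suc p)) k)) x (i # v)) =
      dirichlet (Suc p) k (\<lambda>v. x (i # v)) + x [i] * (x [i] - x [])" if "i < k" for i
  proof -
    have "(\<Sum>v\<in>?V. x (i # v) * lap (fst (bethe (Suc (Suc p)) k)) x (i # v)) =
        (\<Sum>v\<in>?V. x (i # v) * lap (fst (bethe (Suc p) k)) (\<lambda>v. x (i # v)) v +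
          (if v = [] then x [i] * (x [i] - x []) else 0))"
      by (intro sum.cong refl) (auto simp: lap_bethe_Cons[OF that] algebra_simps)
    then show ?thesis
      by (simp add: sum.distrib dirichlet_def finite_pverts_bethe Nil_in_bethe)
  qed
  then have "dirichlet (Suc (Suc p)) k x = x [] * (\<Sum>i<k. x [] - x [i]) +
      (\<Sum>i<k. dirichlet (Suc p) k (\<lambda>v. x (i # v)) + x [i] * (x [i] - x []))"
    unfolding dirichlet_def[of "Suc (Suc p)"] sum_pverts_bethe_Suc lap_bethe_Nil by simp
  also have "\<dots> = (\<Sum>i<k. x [] * (x [] - x [i]) +
      (dirichlet (Suc p) k (\<lambda>v. x (i # v)) + x [i] * (x [i] - x [])))"
    by (simp add: sum_distrib_left sum.distrib)
  also have "\<dots> = (\<Sum>i<k. dirichlet (Suc p) k (\<lambda>v. x (i # v)) + (x [] - x [i])\<^sup>2)"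
    by (intro sum.cong refl) (simp add: power2_eq_square algebra_simps)
  finally show ?thesis .
qed

lemma dirichlet_nonneg: "dirichlet (Suc p) k x \<ge> 0"
proof (induction p arbitrary: x)
  case 0
  show ?case by (simp add: dirichlet_1)
next
  case (Suc p)
  then show ?case unfolding dirichlet_Suc by (intro sum_nonneg add_nonneg_nonneg) auto
qed

lemma dirichlet_eq_0:
  "dirichlet (Suc p) k x = 0 \<Longrightarrow> v \<in> pverts (fst (bethe (Suc p) k)) \<Longrightarrow> x v = x []"
proof (induction p arbitrary: x v)
  case (Suc p)
  have summand: "dirichlet (Suc p) k (\<lambda>v. x (i # v)) + (x [] - x [i])\<^sup>2 = 0" if "i < k" for i
    using Suc.prems(1) that unfolding dirichlet_Suc
    by (subst (asm) sum_nonneg_eq_0_iff) (auto intro!: add_nonneg_nonneg dirichlet_nonneg)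
  have "x (i # w) = x []" if "i < k" "w \<in> pverts (fst (bethe (Suc p) k))" for i w
  proof -
    have "dirichlet (Suc p) k (\<lambda>v. x (i # v)) = 0" "(x [] - x [i])\<^sup>2 = 0"
      using summand[OF that(1)] dirichlet_nonneg[of p k "\<lambda>v. x (i # v)"]
      by (auto simp: add_nonneg_eq_0_iff)
    with Suc.IH[OF this(1) that(2)] show ?thesis by simp
  qed
  with Suc.prems(2) show ?case unfolding pverts_bethe_Suc by blast
qed simp

text \<open>The best constant in front of the squared root value is found by minimising over the subtrees below the
  root: if it is \<open>a - 1\<close> for \<open>B_p\<close>, then a child with value \<open>t\<close> below a root with value \<open>s\<close> contributes at
  least the minimum over \<open>t\<close> of \<open>(a - 1) t^2 + (s - t)^2\<close>, which is \<open>(1 - 1 / a) s^2\<close> if \<open>a > 0\<close>. The resulting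
  recursion for \<open>a\<close> is the one satisfied by ratios of consecutive levels of \<open>radial\<close>.\<close>

lemma dirichlet_ground_state:
  assumes "\<And>j. j \<le> Suc p \<Longrightarrow> radial k l j > 0"
  shows "(radial k l (Suc (Suc p)) / radial k l (Suc p) - 1) * (x [])\<^sup>2 \<le>
    dirichlet (Suc p) k x - l * sq_norm (Suc p) k x"
  using assms
proof (induction p arbitrary: x)
  case 0
  show ?case by (simp add: dirichlet_1 sq_norm_1 radial.simps(3) algebra_simps)
next
  case (Suc p)
  define a where "a = radial k l (Suc (Suc p)) / radial k l (Suc p)"
  have pos: "radial k l (Suc p) > 0" "radial k l (Suc (Suc p)) > 0"
    using Suc.prems[of "Suc p"] Suc.prems[of "Suc (Suc p)"] by auto
  then have a: "a > 0" by (simp add: a_def)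
  have quad: "(1 - 1 / a) * s\<^sup>2 \<le> (a - 1) * t\<^sup>2 + (s - t)\<^sup>2" for s t :: real
  proof -
    have "(a - 1) * t\<^sup>2 + (s - t)\<^sup>2 - (1 - 1 / a) * s\<^sup>2 = (a * t - s)\<^sup>2 / a"
      using a by (simp add: field_simps power2_eq_square)
    also have "\<dots> \<ge> 0" using a by simp
    finally show ?thesis by simp
  qed
  have ratio: "radial k l (Suc (Suc (Suc p))) / radial k l (Suc (Suc p)) - 1 = k * (1 - 1 / a) - l"
    using pos by (simp add: a_def radial.simps(3)[of _ _ "Suc p"] field_simps)
  have "(radial k l (Suc (Suc (Suc p))) / radial k l (Suc (Suc p)) - 1) * (x [])\<^sup>2 =
      (\<Sum>i<k. (1 - 1 / a) * (x [])\<^sup>2) - l * (x [])\<^sup>2"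
    unfolding ratio by (simp add: algebra_simps)
  also have "\<dots> \<le> (\<Sum>i<k. (a - 1) * (x [i])\<^sup>2 + (x [] - x [i])\<^sup>2) - l * (x [])\<^sup>2"
    by (intro diff_right_mono sum_mono quad)
  also have "\<dots> \<le> (\<Sum>i<k. dirichlet (Suc p) k (\<lambda>v. x (i # v)) - l * sq_norm (Suc p) k (\<lambda>v. x (i # v))
      + (x [] - x [i])\<^sup>2) - l * (x [])\<^sup>2"
    unfolding a_def
    by (intro diff_right_mono sum_mono add_right_mono Suc.IH Suc.prems) auto
  also have "\<dots> = dirichlet (Suc (Suc p)) k x - l * sq_norm (Suc (Suc p)) k x"
    by (simp add: dirichlet_Suc sq_norm_Suc sum.distrib sum_subtractf sum_distrib_left algebra_simps)
  finally show ?case .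
qed

text \<open>For a branch the ratio of levels in the previous lemma is \<open>0\<close>, since \<open>l\<close> is a root. The lost square of
  the branch's root value is made up for by the edge that joins the branch to the root, where \<open>x\<close>
  vanishes.\<close>

lemma dirichlet_ge_of_zero_at_root:
  assumes pos: "\<And>j. j \<le> Suc q \<Longrightarrow> radial k l j > 0"
    and root: "radial k l (Suc (Suc q)) = 0" and x: "x [] = 0"
  shows "l * sq_norm (Suc (Suc q)) k x \<le> dirichlet (Suc (Suc q)) k x"
proof -
  have "0 \<le> dirichlet (Suc q) k (\<lambda>v. x (i # v)) - l * sq_norm (Suc q) k (\<lambda>v. x (i # v)) + (x [i])\<^sup>2" for i
    using dirichlet_ground_state[OF pos, of q "\<lambda>v. x (i # v)"] root by simp
  then have "0 \<le> (\<Sum>i<k. dirichlet (Suc q) k (\<lambda>v. x (i # v)) - l * sq_norm (Suc q) k (\<lambda>v. x (i # v)) + (x [i])\<^sup>2)"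
    by (intro sum_nonneg)
  also have "\<dots> = dirichlet (Suc (Suc q)) k x - l * sq_norm (Suc (Suc q)) k x"
    by (simp add: dirichlet_Suc sq_norm_Suc sum.distrib sum_subtractf sum_distrib_left x algebra_simps)
  finally show ?thesis by simp
qed

text \<open>Shifting the eigenvector by the constant \<open>x []\<close> produces a vector \<open>y\<close> that vanishes at the root, has the
  same quadratic form \<open>e |x|^2\<close> and, because \<open>e \<noteq> 0\<close> makes \<open>x\<close> sum to zero, has \<open>|y| \<ge> |x|\<close>. This replaces
  Cauchy interlacing for the deletion of the root.\<close>

lemma lap_bethe_eigenvalue_ge:
  assumes pos: "\<And>j. j \<le> Suc q \<Longrightarrow> radial k l j > 0"
    and root: "radial k l (Suc (Suc q)) = 0" and l: "l \<ge> 0"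
    and eig: "\<And>u. u \<in> pverts (fst (bethe (Suc (Suc q)) k)) \<Longrightarrow>
      lap (fst (bethe (Suc (Suc q)) k)) x u = e * x u"
    and nz: "v \<in> pverts (fst (bethe (Suc (Suc q)) k))" "x v \<noteq> 0" and e: "e \<noteq> 0"
  shows "l \<le> e"
proof -
  let ?V = "pverts (fst (bethe (Suc (Suc q)) k))"
  let ?L = "lap (fst (bethe (Suc (Suc q)) k))"
  define y where "y u = x u - x []" for u
  have fin: "finite ?V" by (rule finite_pverts_bethe)
  have "e * (\<Sum>u\<in>?V. x u) = (\<Sum>u\<in>?V. ?L x u)"
    by (simp add: sum_distrib_left eig)
  also have "\<dots> = 0" by (rule sum_lap_bethe)
  finally have sum0: "(\<Sum>u\<in>?V. x u) = 0" using e by simp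
  have Ly: "?L y u = ?L x u" for u by (simp add: lap_def y_def)
  have "dirichlet (Suc (Suc q)) k y = (\<Sum>u\<in>?V. (x u - x []) * (e * x u))"
    unfolding dirichlet_def Ly by (intro sum.cong refl) (simp add: eig y_def)
  also have "\<dots> = e * sq_norm (Suc (Suc q)) k x - e * x [] * (\<Sum>u\<in>?V. x u)"
    by (simp add: sq_norm_def sum_subtractf sum_distrib_left power2_eq_square algebra_simps)
  finally have dy: "dirichlet (Suc (Suc q)) k y = e * sq_norm (Suc (Suc q)) k x"
    by (simp add: sum0)
  have "sq_norm (Suc (Suc q)) k y =
      sq_norm (Suc (Suc q)) k x - 2 * x [] * (\<Sum>u\<in>?V. x u) + real (card ?V) * (x [])\<^sup>2"
    by (simp add: sq_norm_def y_def power2_diff sum.distrib sum_subtractf sum_distrib_left algebra_simps)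
  then have "sq_norm (Suc (Suc q)) k x \<le> sq_norm (Suc (Suc q)) k y"
    by (simp add: sum0)
  then have "l * sq_norm (Suc (Suc q)) k x \<le> l * sq_norm (Suc (Suc q)) k y"
    using l by (rule mult_left_mono)
  also have "\<dots> \<le> e * sq_norm (Suc (Suc q)) k x"
    unfolding dy[symmetric]
    by (rule dirichlet_ge_of_zero_at_root[OF pos root]) (auto simp: y_def)
  finally have "l * sq_norm (Suc (Suc q)) k x \<le> e * sq_norm (Suc (Suc q)) k x" .
  moreover have "sq_norm (Suc (Suc q)) k x > 0"
    unfolding sq_norm_def using nz fin by (intro sum_pos2[of _ v]) auto
  ultimately show ?thesis by simp
qed

text \<open>The level of \<open>v\<close> is \<open>p + 1 - length v\<close>. The eigenvalue equation fails at the root only, which has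
  no parent; the defect is what a parent at level \<open>p + 2\<close> would contribute. The factor \<open>c\<close>
  lets the lemma apply directly to signed copies on the branches.\<close>

lemma lap_bethe_radial:
  "u \<in> pverts (fst (bethe (Suc p) k)) \<Longrightarrow>
    lap (fst (bethe (Suc p) k)) (\<lambda>v. c * radial k l (Suc p - length v)) u =
    l * (c * radial k l (Suc p - length u)) +
    (if u = [] then c * (radial k l (Suc (Suc p)) - radial k l (Suc p)) else 0)"
proof (induction p arbitrary: u)
  case 0
  then show ?case by (simp add: radial.simps(3) algebra_simps)
next
  case (Suc p)
  show ?case
  proof (cases u)
    case Nil
    then show ?thesis by (simp add: lap_bethe_Nil radial.simps(3)[of _ _ "Suc p"] algebra_simps)
  next
    case (Cons i w)
    with Suc.prems have "i < k" "w \<in> pverts (fst (bethe (Suc p) k))"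
      unfolding pverts_bethe_Suc by auto
    with Suc.IH[of w] Cons show ?thesis
      by (simp add: lap_bethe_Cons algebra_simps)
  qed
qed

definition antisym_radial :: "real \<Rightarrow> real \<Rightarrow> nat \<Rightarrow> nat list \<Rightarrow> real" where
  "antisym_radial k l q u = (case u of [] \<Rightarrow> 0 | i # v \<Rightarrow>
    (if i = 0 then 1 else if i = 1 then - 1 else 0) * radial k l (q - length v))"

text \<open>On each branch the defect at the branch's root cancels against the edge to the root of the whole tree,
  because the recurrence vanishes one level up. At the root itself the contributions of the two
  branches cancel.\<close>

lemma lap_bethe_antisym:
  assumes k: "k \<ge> 2" and root: "radial k l (Suc (Suc q)) = 0"
    and u: "u \<in> pverts (fst (bethe (Suc (Suc q)) k))"
  shows "lap (fst (bethe (Suc (Suc q)) k)) (antisym_radial k l (Suc q)) u = l * antisym_radial k l (Suc q) u"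
proof (cases u)
  case Nil
  let ?c = "\<lambda>i :: nat. if i = 0 then 1 else if i = 1 then - 1 else 0 :: real"
  have "(\<Sum>i<k. ?c i * r) = 0" for r
  proof -
    have "(\<Sum>i<k. ?c i * r) = (\<Sum>i\<in>{0, 1}. ?c i * r)"
      using k by (intro sum.mono_neutral_right) auto
    then show ?thesis by simp
  qed
  then show ?thesis unfolding Nil lap_bethe_Nil
    by (simp add: antisym_radial_def sum_negf)
next
  case (Cons i w)
  have branch: "(\<lambda>v. antisym_radial k l (Suc q) (i # v)) =
      (\<lambda>v. (if i = 0 then 1 else if i = 1 then - 1 else 0) * radial k l (Suc q - length v))"
    by (simp add: antisym_radial_def fun_eq_iff)
  from Cons u have "i < k" "w \<in> pverts (fst (bethe (Suc q) k))"
    unfolding pverts_bethe_Suc by auto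
  then show ?thesis
    unfolding Cons lap_bethe_Cons[OF \<open>i < k\<close>] branch
    by (auto simp: lap_bethe_radial root antisym_radial_def)
qed

section \<open>Paths to the root and the bottleneck matrix\<close>

fun climb :: "nat list \<Rightarrow> nat list list" where
  "climb [] = [[]]"
| "climb (i # v) = map ((#) i) (climb v) @ [[]]"

lemma climb_facts [simp]: "climb v \<noteq> []" "hd (climb v) = v" "last (climb v) = []"
  by (induction v) (auto simp: hd_map hd_append)

lemma distinct_climb: "distinct (climb v)"
  by (induction v) (auto simp: distinct_map)

lemma vwalk_arcs_map: "vwalk_arcs (map f xs) = map (\<lambda>(u, v). (f u, f v)) (vwalk_arcs xs)"
  by (induction xs rule: vwalk_arcs.induct) auto

lemma vwalk_climb:
  "v \<in> pverts (fst (bethe (Suc p) k)) \<Longrightarrow> vwalk (climb v) (with_proj (fst (bethe (Suc p) k)))"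
proof (induction p arbitrary: v)
  case 0
  then show ?case by (auto simp: vwalk_def)
next
  case (Suc p)
  show ?case
  proof (cases v)
    case Nil
    then show ?thesis using Nil_in_bethe[of "Suc p" k] by (simp add: vwalk_def)
  next
    case (Cons i w)
    with Suc.prems have i: "i < k" and w: "w \<in> pverts (fst (bethe (Suc p) k))"
      unfolding pverts_bethe_Suc by auto
    note IH = Suc.IH[OF w, unfolded vwalk_def]
    have "set (vwalk_arcs (climb v)) \<subseteq> parcs (fst (bethe (Suc (Suc p)) k))"
      using IH i unfolding Cons
      by (auto simp: vwalk_arcs_append vwalk_arcs_map last_map parcs_bethe_Suc)
    moreover have "set (climb v) \<subseteq> pverts (fst (bethe (Suc (Suc p)) k))"
      using IH i unfolding Cons pverts_bethe_Suc by (auto)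
    ultimately show ?thesis by (simp add: vwalk_def)
  qed
qed

lemma distinct_hd_eq_last:
  assumes "xs \<noteq> []" "distinct xs" "hd xs = a" "last xs = a"
  shows "xs = [a]"
proof (cases xs)
  case (Cons b ys)
  then have "ys = []"
    using assms last_in_set[of ys] by (auto split: if_splits)
  with Cons assms(3) show ?thesis by simp
qed (use assms in simp)

text \<open>A path that ends in the root without repeating a vertex meets the root only at its end, so
  before that it cannot leave the branch it starts in.\<close>

lemma vpath_in_branch:
  assumes "vwalk xs (with_proj (fst (bethe (Suc (Suc p)) k)))" "distinct xs" "last xs = []"
    "hd xs = i # v"
  shows "\<exists>ys. xs = map ((#) i) ys @ [[]] \<and> vwalk ys (with_proj (fst (bethe (Suc p) k))) \<and>
    hd ys = v \<and> last ys = []"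
  using assms
proof (induction xs arbitrary: v rule: list.induct)
  case Nil
  then show ?case by (simp add: vwalk_def)
next
  case (Cons w xs)
  have w: "w = i # v" using Cons.prems by simp
  have ne: "xs \<noteq> []" using Cons.prems w by auto
  have arc: "(i # v, hd xs) \<in> parcs (fst (bethe (Suc (Suc p)) k))"
    and walk: "vwalk xs (with_proj (fst (bethe (Suc (Suc p)) k)))"
    using Cons.prems(1) ne w by (auto elim!: vwalk_consE)
  have last: "last xs = []" using Cons.prems(3) ne by simp
  have v: "v \<in> pverts (fst (bethe (Suc p) k))"
    using Cons.prems(1) unfolding vwalk_def w pverts_bethe_Suc with_proj_simps by auto
  consider (down) v' where "hd xs = i # v'" "(v, v') \<in> parcs (fst (bethe (Suc p) k))"
    | (root) "v = []" "hd xs = []"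
    using arc unfolding parcs_bethe_Suc by auto
  then show ?case
  proof cases
    case down
    with Cons.IH[OF walk _ last, of v'] Cons.prems(2) obtain ys where
      ys: "xs = map ((#) i) ys @ [[]]" "vwalk ys (with_proj (fst (bethe (Suc p) k)))"
        "hd ys = v'" "last ys = []" by auto
    then have "vwalk (v # ys) (with_proj (fst (bethe (Suc p) k)))"
      using v down by (intro vwalk_consI) auto
    moreover have "ys \<noteq> []" using ys(2) by (simp add: vwalk_def)
    ultimately show ?thesis using ys w by (intro exI[of _ "v # ys"]) auto
  next
    case root
    have "xs = [[]]"
      using ne Cons.prems(2) last root(2) by (intro distinct_hd_eq_last) auto
    then show ?thesis using w root v by (intro exI[of _ "[v]"]) (auto simp: vwalk_def)
  qed
qed

lemma vwalk_to_root_unique: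
  assumes "vwalk xs (with_proj (fst (bethe (Suc p) k)))" "distinct xs" "last xs = []" "hd xs = v"
  shows "xs = climb v"
  using assms
proof (induction p arbitrary: xs v rule: nat.induct)
  case zero
  then have "v = []" "xs \<noteq> []" by (cases xs; auto simp: vwalk_def)+
  with zero distinct_hd_eq_last[of xs "[]"] show ?case by simp
next
  case (Suc p)
  have ne: "xs \<noteq> []" using Suc.prems(1) by (simp add: vwalk_def)
  show ?case
  proof (cases v)
    case Nil
    with Suc.prems ne distinct_hd_eq_last[of xs "[]"] show ?thesis by simp
  next
    case (Cons i w)
    with vpath_in_branch[OF Suc.prems(1-3)] Suc.prems(4) obtain ys where
      ys: "xs = map ((#) i) ys @ [[]]" "vwalk ys (with_proj (fst (bethe (Suc p) k)))"
        "hd ys = w" "last ys = []" by blast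
    have "distinct ys" using Suc.prems(2) ys(1) by (auto simp: distinct_map)
    from Suc.IH[OF ys(2) this ys(4,3)] show ?thesis using ys(1) Cons by simp
  qed
qed

lemma path_to_root_bethe:
  assumes "v \<in> pverts (fst (bethe (Suc p) k))"
  shows "path_to_root (bethe (Suc p) k) v = climb v"
  unfolding path_to_root_def
proof (rule the_equality)
  show "vpath (climb v) (with_proj (fst (bethe (Suc p) k))) \<and> hd (climb v) = v \<and>
      last (climb v) = snd (bethe (Suc p) k)"
    using vwalk_climb[OF assms] by (simp add: vpath_def distinct_climb)
qed (auto simp: vpath_def intro: vwalk_to_root_unique)

definition bottleneck :: "nat list \<Rightarrow> nat list \<Rightarrow> real" where
  "bottleneck u v = real (card (set (climb u) \<inter> set (climb v)))"

lemma bottleneck_Nil: "bottleneck [] v = 1"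
  by (cases v) (auto simp: bottleneck_def)

lemma bottleneck_Nil2: "bottleneck v [] = 1"
  by (cases v) (auto simp: bottleneck_def)

lemma bottleneck_Cons:
  "bottleneck (i # u) (j # v) = 1 + (if i = j then bottleneck u v else 0)"
proof -
  have "set (climb (i # u)) \<inter> set (climb (j # v)) =
      insert [] (if i = j then (#) i ` (set (climb u) \<inter> set (climb v)) else {})"
    by auto
  then show ?thesis
    by (simp add: bottleneck_def card_image image_iff)
qed

text \<open>The Laplacian of a function sums to zero, so summing the equations of \<open>lap_bethe_radial\<close> leaves
  the defect at the root.\<close>

lemma sum_radial_bethe:
  "l * (\<Sum>v\<in>pverts (fst (bethe (Suc p) k)). radial k l (Suc p - length v)) =
    radial k l (Suc p) - radial k l (Suc (Suc p))"
proof -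
  let ?V = "pverts (fst (bethe (Suc p) k))"
  let ?f = "\<lambda>v. radial k l (Suc p - length v)"
  have "0 = (\<Sum>u\<in>?V. lap (fst (bethe (Suc p) k)) (\<lambda>v. 1 * ?f v) u)"
    by (rule sum_lap_bethe[symmetric])
  also have "\<dots> = (\<Sum>u\<in>?V. l * ?f u +
      (if u = [] then radial k l (Suc (Suc p)) - radial k l (Suc p) else 0))"
    by (rule sum.cong) (auto simp: lap_bethe_radial[where c = 1, simplified])
  also have "\<dots> = l * (\<Sum>u\<in>?V. ?f u) + (radial k l (Suc (Suc p)) - radial k l (Suc p))"
    by (simp add: sum.distrib sum_distrib_left finite_pverts_bethe Nil_in_bethe)
  finally show ?thesis by simp
qed

text \<open>Two vertices of one branch share the root and what their paths share inside the branch; vertices of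
  different branches share the root only. The row sum for \<open>i # w\<close> is therefore the total sum plus the row
  sum for \<open>w\<close> in the branch, and the right-hand sides telescope. At a root of \<open>radial\<close> the last
  term vanishes and the level vector is an eigenvector.\<close>

lemma bottleneck_radial:
  "u \<in> pverts (fst (bethe (Suc p) k)) \<Longrightarrow>
    l * (\<Sum>v\<in>pverts (fst (bethe (Suc p) k)). bottleneck u v * radial k l (Suc p - length v)) =
    radial k l (Suc p - length u) - radial k l (Suc (Suc p))"
proof (induction p arbitrary: u)
  case 0
  then show ?case by (simp add: bottleneck_Nil radial.simps(3) algebra_simps)
next
  case (Suc p)
  show ?case
  proof (cases u)
    case Nil
    then show ?thesis using sum_radial_bethe[of l k "Suc p"] by (simp add: bottleneck_Nil)
  next
    case (Cons i w)
    with Suc.prems have i: "i < k" and w: "w \<in> pverts (fst (bethe (Suc p) k))"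
      unfolding pverts_bethe_Suc by auto
    let ?V = "pverts (fst (bethe (Suc p) k))"
    let ?r = "\<lambda>v. radial k l (Suc p - length v)"
    have "(\<Sum>j<k. \<Sum>v\<in>?V. bottleneck u (j # v) * ?r v) =
        (\<Sum>j<k. (\<Sum>v\<in>?V. ?r v) + (if i = j then \<Sum>v\<in>?V. bottleneck w v * ?r v else 0))"
      unfolding Cons
      by (intro sum.cong refl) (auto simp: bottleneck_Cons sum.distrib algebra_simps)
    also have "\<dots> = (\<Sum>j<k. \<Sum>v\<in>?V. ?r v) + (\<Sum>v\<in>?V. bottleneck w v * ?r v)"
      using i by (simp add: sum.distrib)
    finally have "(\<Sum>v\<in>pverts (fst (bethe (Suc (Suc p)) k)).
          bottleneck u v * radial k l (Suc (Suc p) - length v)) =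
        (\<Sum>v\<in>pverts (fst (bethe (Suc (Suc p)) k)). radial k l (Suc (Suc p) - length v)) +
        (\<Sum>v\<in>?V. bottleneck w v * ?r v)"
      unfolding sum_pverts_bethe_Suc by (simp add: bottleneck_Nil2)
    with sum_radial_bethe[of l k "Suc p"] Suc.IH[OF w] show ?thesis
      by (simp add: Cons distrib_left)
  qed
qed

lemma bottleneck_mat_bethe:
  "bottleneck_mat (bethe (Suc p) k) = indexed_mat (pverts (fst (bethe (Suc p) k))) bottleneck"
  unfolding bottleneck_mat_def
  by (rule indexed_mat_cong[OF finite_pverts_bethe]) (simp add: path_to_root_bethe bottleneck_def)

section \<open>Algebraic connectivity and Perron value\<close>

lemma perron_value_bethe:
  assumes pos: "\<And>j. j \<le> Suc q \<Longrightarrow> radial k l j > 0" and l: "l > 0"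
    and root: "radial k l (Suc (Suc q)) = 0"
  shows "perron_value (bethe (Suc q) k) = 1 / l"
  unfolding perron_value_def bottleneck_mat_bethe
proof (rule spectral_radius_eq_positive_eigenvalue)
  let ?V = "pverts (fst (bethe (Suc q) k))"
  show "?V \<noteq> {}" using Nil_in_bethe by blast
  show "radial k l (Suc q - length v) > 0" for v
    by (rule pos) simp
  show "(\<Sum>v\<in>?V. bottleneck u v * radial k l (Suc q - length v)) =
      1 / l * radial k l (Suc q - length u)" if "u \<in> ?V" for u
    using bottleneck_radial[OF that, of l] root l by (simp add: field_simps)
qed (auto simp: bottleneck_def finite_pverts_bethe Int_commute)

lemma algebraic_connectivity_bethe:
  assumes k: "k \<ge> 2" and pos: "\<And>j. j \<le> Suc q \<Longrightarrow> radial k l j > 0" and l: "l > 0"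
    and root: "radial k l (Suc (Suc q)) = 0"
  shows "algebraic_connectivity (fst (bethe (Suc (Suc q)) k)) = l"
proof -
  define G where "G = fst (bethe (Suc (Suc q)) k)"
  let ?V = "pverts G"
  have fin: "finite ?V" unfolding G_def by (rule finite_pverts_bethe)
  have Nil: "[] \<in> ?V" unfolding G_def by (rule Nil_in_bethe)
  have wf: "v \<in> ?V" if "(u, v) \<in> parcs G" for u v
    using that bethe_wf unfolding G_def by blast
  have sum_lap: "(\<Sum>v\<in>?V. lap_entry G u v * x v) = lap G x u" if "u \<in> ?V" for x u
    by (rule sum_lap_entry[OF fin _ that]) (rule wf)
  have ev: "eigenvalue (laplacian_mat G) e \<longleftrightarrow>
      (\<exists>x. (\<exists>v\<in>?V. x v \<noteq> 0) \<and> (\<forall>u\<in>?V. lap G x u = e * x u))" for e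
    unfolding laplacian_mat_eq eigenvalue_indexed_mat[OF fin] by (simp add: sum_lap)
  have rows: "(\<Sum>v\<in>?V. lap_entry G u v) = 0" if "u \<in> ?V" for u
    using sum_lap[OF that, of "\<lambda>_. 1"] by (simp add: lap_def)
  show ?thesis
    unfolding algebraic_connectivity_def G_def[symmetric]
  proof (rule second_root_char_poly)
    show "laplacian_mat G \<in> carrier_mat (card ?V) (card ?V)"
      by (simp add: laplacian_mat_eq)
    show "order 0 (char_poly (laplacian_mat G)) = 1"
      unfolding laplacian_mat_eq
    proof (rule order_0_char_poly_of_constant_kernel[OF fin])
      show "(\<Sum>u\<in>?V. lap_entry G u v) = 0" if v: "v \<in> ?V" for v
      proof -
        have "lap_entry G u v = lap_entry G v u" for u
          using bethe_symmetric unfolding G_def lap_entry_def by auto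
        then show ?thesis using rows[OF v] by simp
      qed
      show "x u = x v" if "\<And>u. u \<in> ?V \<Longrightarrow> (\<Sum>v\<in>?V. lap_entry G u v * x v) = 0"
        "u \<in> ?V" "v \<in> ?V" for x u v
      proof -
        have "dirichlet (Suc (Suc q)) k x = 0"
          unfolding dirichlet_def G_def[symmetric] using that(1) by (simp add: sum_lap)
        from dirichlet_eq_0[OF this] that(2,3) show ?thesis
          unfolding G_def by metis
      qed
    qed (use Nil rows in auto)
    show "eigenvalue (laplacian_mat G) l"
      unfolding ev
    proof (intro exI[of _ "antisym_radial k l (Suc q)"] conjI ballI)
      have "[0] \<in> ?V"
        using k Nil_in_bethe[of q k] unfolding G_def pverts_bethe_Suc by auto
      moreover have "antisym_radial k l (Suc q) [0] \<noteq> 0"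
        using pos[of "Suc q"] by (simp add: antisym_radial_def)
      ultimately show "\<exists>v\<in>?V. antisym_radial k l (Suc q) v \<noteq> 0" by blast
    qed (use lap_bethe_antisym[OF k root] in \<open>auto simp: G_def\<close>)
    show "l \<le> e" if e: "eigenvalue (laplacian_mat G) e" "e \<noteq> 0" for e
    proof -
      obtain x v where "v \<in> ?V" "x v \<noteq> 0" "\<And>u. u \<in> ?V \<Longrightarrow> lap G x u = e * x u"
        using e(1) unfolding ev by blast
      then show ?thesis
        using lap_bethe_eigenvalue_ge[OF pos root less_imp_le[OF l], of x e v] e(2)
        unfolding G_def by blast
    qed
  qed (rule l)
qed

theorem mainTheorem4:
  fixes p k :: nat
  assumes "p \<ge> 2" and "k \<ge> 2"
  shows "algebraic_connectivity (fst (bethe p k)) = 1 / perron_value (bethe (p - 1) k)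
    \<and> 1 / perron_value (bethe (p - 1) k)
        \<ge> (real k - 1)\<^sup>2 / (real k ^ p - real p * real k + real p - 1)"
proof -
  obtain q where p: "p = Suc (Suc q)"
    using assms(1) by (metis Suc_le_D numeral_2_eq_2 Suc_le_mono)
  have "real k > 0" using assms(2) by simp
  from radial_first_root[OF this, of q] obtain l where l: "l > 0" "radial k l (Suc (Suc q)) = 0"
    and pos: "\<And>j. j \<le> Suc q \<Longrightarrow> radial k l j > 0" by (metis less_imp_le order_refl)
  have conn: "algebraic_connectivity (fst (bethe p k)) = l"
    unfolding p by (rule algebraic_connectivity_bethe[OF assms(2) pos l])
  have perron: "perron_value (bethe (p - 1) k) = 1 / l"
    using perron_value_bethe[OF pos l] by (simp add: p)
  let ?d = "real k ^ p - real p * real k + real p - 1"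
  have "(real k - 1)\<^sup>2 \<le> l * ?d"
    using radial_root_lower_bound[of "real k" l "Suc q"] assms(2) l pos by (simp add: p algebra_simps)
  moreover have "(real k - 1)\<^sup>2 > 0" using assms(2) by simp
  ultimately have "0 < l * ?d" by linarith
  then have "?d > 0" using l(1) by (simp add: zero_less_mult_iff)
  with \<open>(real k - 1)\<^sup>2 \<le> l * ?d\<close> have "(real k - 1)\<^sup>2 / ?d \<le> l"
    by (simp add: divide_le_eq)
  then show ?thesis unfolding conn perron by simp
qed

end
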